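(* Let $k,n\ge 0$ be integers and let $\mathcal S=\{S_0,\ldots,S_{n+1}\}$ be a cover of $\mathbb S^k$ such that $\bigcap_{i=0}^{n+1} S_i=\emptyset$. Then $\mathcal S$ can be extended to a cover $\mathcal F=\{F_0,\ldots,F_{n+1}\}$ of $\mathbb B^{k+1}$ with $\bigcap_{i=0}^{n+1}F_i=\emptyset$ if and only if $[\mathcal S]=0$ in $\pi_k(\mathbb S^n)$ (that is, the homotopy class $[\mathcal S]\in[\mathbb S^k,\mathbb S^n]$ is the class of null-homotopic maps).
   Context: $\mathbb S^n$ is the $n$-dimensional unit sphere, $\mathbb B^n$ the $n$-dimensional unit disk, $\mathbb S^k=\partial \mathbb B^{k+1}$; $[X,Y]$ is the set of homotopy classes of continuous maps $X\to Y$. All spaces are normal. A cover of a space is a finite indexed family of subsets whose union is the space and which consists either entirely of open sets or entirely of closed sets. If $A\subset X$, $\mathcal S=\{S_0,\ldots,S_m\}$ is a cover of $A$ and $\mathcal F=\{F_0,\ldots,F_m\}$ is a cover of $X$, then $\mathcal F$ extends $\mathcal S$ if $\mathcal F$ is open when $\mathcal S$ is open, closed when $\mathcal S$ is closed, and $S_i=F_i\cap A$ for all $i$. The class of a cover. Let $\Delta^m$ be an $m$-simplex with vertices $v_0,\ldots,v_m$ and fix a homeomorphism $|\partial\Delta^m|\cong\mathbb S^{m-1}$. If $\mathcal U=\{U_0,\ldots,U_m\}$ is an open cover of a space $T$ with $\bigcap_i U_i=\emptyset$ and $\{\varphi_0,\ldots,\varphi_m\}$ is a partition of unity subordinate to $\mathcal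 U$ ($\operatorname{supp}\varphi_i\subset U_i$), then $\rho(x)=\sum_{i=0}^m\varphi_i(x)v_i$ is a continuous map $T\to|\partial\Delta^m|\cong\mathbb S^{m-1}$, whose homotopy class does not depend on the partition of unity; it is denoted $[\mathcal U]\in[T,\mathbb S^{m-1}]$. If $\mathcal C=\{C_0,\ldots,C_m\}$ is a closed cover of $T$ with $\bigcap_iC_i=\emptyset$, then $[\mathcal C]:=[\mathcal U]$ for any open cover $\mathcal U=\{U_0,\ldots,U_m\}$ with $C_i\subset U_i$ for all $i$ and such that for every set of indices $J$, $\bigcap_{j\in J}U_j\ne\emptyset$ if and only if $\bigcap_{j\in J}C_j\neq\emptyset$; such $\mathcal U$ exist and the class does not depend on the choice. *)

theory Defs
  imports "HOL-Analysis.Analysis"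
begin

text \<open>
  A space is an abstract topology. A finite indexed family \<open>S\<^sub>0, \<dots>, S\<^sub>m\<close> is a function
  \<open>S :: nat \<Rightarrow> 'a set\<close> of which only the values at indices \<open>\<le> m\<close> matter. A family may consist
  of clopen sets, so whether a cover is regarded as open or as closed is explicit data.
\<close>

datatype cover_kind = Open_Cover | Closed_Cover

fun of_kind :: "cover_kind \<Rightarrow> 'a topology \<Rightarrow> 'a set \<Rightarrow> bool" where
  "of_kind Open_Cover X A \<longleftrightarrow> openin X A"
| "of_kind Closed_Cover X A \<longleftrightarrow> closedin X A"

definition is_cover :: "cover_kind \<Rightarrow> nat \<Rightarrow> 'a topology \<Rightarrow> (nat \<Rightarrow> 'a set) \<Rightarrow> bool" where
  "is_cover kind m X S \<longleftrightarrow> (\<forall>i\<le>m. of_kind kind X (S i)) \<and> (\<Union>i\<le>m. S i) = topspace X"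

definition extends_cover ::
  "cover_kind \<Rightarrow> nat \<Rightarrow> 'a topology \<Rightarrow> (nat \<Rightarrow> 'a set) \<Rightarrow> 'a set \<Rightarrow> (nat \<Rightarrow> 'a set) \<Rightarrow> bool" where
  "extends_cover kind m X F A S \<longleftrightarrow>
     A \<subseteq> topspace X \<and> is_cover kind m (subtopology X A) S \<and> is_cover kind m X F \<and>
     (\<forall>i\<le>m. S i = F i \<inter> A)"

definition homotopy_class :: "'a topology \<Rightarrow> 'b topology \<Rightarrow> ('a \<Rightarrow> 'b) \<Rightarrow> ('a \<Rightarrow> 'b) set" where
  "homotopy_class X Y f = {g. homotopic_with (\<lambda>_. True) X Y f g}"

text \<open>
  For disconnected \<open>Y\<close> there is more than one class of null-homotopic maps.
\<close>

definition null_class :: "'a topology \<Rightarrow> 'b topology \<Rightarrow> ('a \<Rightarrow> 'b) set \<Rightarrow> bool" where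
  "null_class X Y c \<longleftrightarrow> (\<exists>y\<in>topspace Y. c = homotopy_class X Y (\<lambda>_. y))"

definition subordinate_partition ::
  "nat \<Rightarrow> 'a topology \<Rightarrow> (nat \<Rightarrow> 'a set) \<Rightarrow> (nat \<Rightarrow> 'a \<Rightarrow> real) \<Rightarrow> bool" where
  "subordinate_partition m X U \<phi> \<longleftrightarrow>
     (\<forall>i\<le>m. continuous_map X euclideanreal (\<phi> i)) \<and>
     (\<forall>i\<le>m. \<forall>x\<in>topspace X. 0 \<le> \<phi> i x) \<and>
     (\<forall>x\<in>topspace X. (\<Sum>i\<le>m. \<phi> i x) = 1) \<and>
     (\<forall>i\<le>m. X closure_of {x \<in> topspace X. \<phi> i x \<noteq> 0} \<subseteq> U i)"

definition simplex_vertices :: "nat \<Rightarrow> (nat \<Rightarrow> 'c::euclidean_space) \<Rightarrow> bool" where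
  "simplex_vertices m v \<longleftrightarrow> inj_on v {..m} \<and> \<not> affine_dependent (v ` {..m})"

definition simplex_boundary :: "nat \<Rightarrow> (nat \<Rightarrow> 'c::euclidean_space) \<Rightarrow> 'c set" where
  "simplex_boundary m v = rel_frontier (convex hull (v ` {..m}))"

text \<open>
  The class of a cover with empty intersection, for a simplex with vertices \<open>v\<close> and a
  homeomorphism \<open>h\<close> from its boundary onto the unit sphere. The definite descriptions rely on
  the class depending neither on the partition of unity nor, for a closed cover, on the
  open cover with the same nerve.
\<close>

definition open_cover_class ::
  "nat \<Rightarrow> (nat \<Rightarrow> 'c::euclidean_space) \<Rightarrow> ('c \<Rightarrow> 'b::euclidean_space) \<Rightarrow>
   'a topology \<Rightarrow> (nat \<Rightarrow> 'a set) \<Rightarrow> ('a \<Rightarrow> 'b) set" where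
  "open_cover_class m v h X U =
     (THE c. \<exists>\<phi>. subordinate_partition m X U \<phi> \<and>
        c = homotopy_class X (top_of_set (sphere 0 1)) (\<lambda>x. h (\<Sum>i\<le>m. \<phi> i x *\<^sub>R v i)))"

definition closed_cover_class ::
  "nat \<Rightarrow> (nat \<Rightarrow> 'c::euclidean_space) \<Rightarrow> ('c \<Rightarrow> 'b::euclidean_space) \<Rightarrow>
   'a topology \<Rightarrow> (nat \<Rightarrow> 'a set) \<Rightarrow> ('a \<Rightarrow> 'b) set" where
  "closed_cover_class m v h X C =
     (THE c. \<exists>U. is_cover Open_Cover m X U \<and> (\<forall>i\<le>m. C i \<subseteq> U i) \<and>
        (\<forall>J\<subseteq>{..m}. (\<Inter>j\<in>J. U j) \<noteq> {} \<longleftrightarrow> (\<Inter>j\<in>J. C j) \<noteq> {}) \<and>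
        c = open_cover_class m v h X U)"

fun cover_class ::
  "cover_kind \<Rightarrow> nat \<Rightarrow> (nat \<Rightarrow> 'c::euclidean_space) \<Rightarrow> ('c \<Rightarrow> 'b::euclidean_space) \<Rightarrow>
   'a topology \<Rightarrow> (nat \<Rightarrow> 'a set) \<Rightarrow> ('a \<Rightarrow> 'b) set" where
  "cover_class Open_Cover m v h X S = open_cover_class m v h X S"
| "cover_class Closed_Cover m v h X S = closed_cover_class m v h X S"

end

theory Submission
  imports Defs
begin

text \<open>
  A partition of unity subordinate to a cover with empty intersection is the same as a map to the
  boundary of the simplex in barycentric coordinates, and a map on the sphere is null-homotopic iff
  it extends to the ball. A cover of the ball (a closed one after swelling it to an open one) gives
  a partition on the ball whose restriction represents \<open>[S]\<close>. Conversely, given coordinates \<open>g\<close> on the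
  ball extending a partition for \<open>S\<close>, shrink them to the ball of radius \<open>1/2\<close> and take there the sets
  where \<open>g i > 0\<close> (open case) or \<open>g i \<ge> 1/(m + 1)\<close> (closed case); on the remaining collar take the
  points whose radial projection lies in \<open>S i\<close>, so that the trace on the sphere is exactly \<open>S\<close>.
\<close>

section \<open>Covers of normal spaces\<close>

text \<open>Normality is applied to one index at a time. Each step replaces a single closed set by a
  closed neighbourhood that creates no new nonempty intersection; finiteness of \<open>M\<close>
  keeps the set to be avoided closed. The closed \<open>D\<close> carry the induction, and the open
  \<open>V\<close> between \<open>C\<close> and \<open>D\<close> are what covers need.\<close>

lemma closed_family_swelling:
  assumes X: "normal_space X" and M: "finite M" and C: "\<And>i. i \<in> M \<Longrightarrow> closedin X (C i)"
  obtains V D where "\<forall>i\<in>M. openin X (V i) \<and> closedin X (D i) \<and> C i \<subseteq> V i \<and> V i \<subseteq> D i"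
    "\<forall>J\<subseteq>M. (\<Inter>j\<in>J. D j) \<noteq> {} \<longrightarrow> (\<Inter>j\<in>J. C j) \<noteq> {}"
proof -
  \<comment> \<open>Indices outside \<open>I\<close> are not yet swollen, but \<open>D\<close> must
    be closed and control the nerve on all of \<open>M\<close>, since the next separation involves
    intersections over arbitrary subsets of \<open>M\<close>.\<close>
  have "\<exists>V D. (\<forall>i\<in>I. openin X (V i) \<and> C i \<subseteq> V i \<and> V i \<subseteq> D i) \<and>
           (\<forall>i\<in>M. closedin X (D i) \<and> C i \<subseteq> D i) \<and>
           (\<forall>J\<subseteq>M. (\<Inter>j\<in>J. D j) \<noteq> {} \<longrightarrow> (\<Inter>j\<in>J. C j) \<noteq> {})" if "finite I" "I \<subseteq> M" for I
    using that
  proof (induction I rule: finite_induct)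
    case empty
    show ?case by (rule exI[of _ C], rule exI[of _ C]) (use C in auto)
  next
    case (insert i I)
    then have "I \<subseteq> M" by simp
    from insert.IH[OF this] obtain V D
      where "\<forall>i\<in>I. openin X (V i) \<and> C i \<subseteq> V i \<and> V i \<subseteq> D i"
        and "\<forall>i\<in>M. closedin X (D i) \<and> C i \<subseteq> D i"
        and "\<forall>J\<subseteq>M. (\<Inter>j\<in>J. D j) \<noteq> {} \<longrightarrow> (\<Inter>j\<in>J. C j) \<noteq> {}"
      by (elim exE conjE) (rule that)
    then have VD: "\<And>j. j \<in> I \<Longrightarrow> openin X (V j) \<and> C j \<subseteq> V j \<and> V j \<subseteq> D j"
      and D: "\<And>j. j \<in> M \<Longrightarrow> closedin X (D j) \<and> C j \<subseteq> D j"
      and nerve: "\<And>J. J \<subseteq> M \<Longrightarrow> (\<Inter>j\<in>J. D j) \<noteq> {} \<Longrightarrow> (\<Inter>j\<in>J. C j) \<noteq> {}"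
      by simp_all
    have i: "i \<in> M" "i \<notin> I" using insert by auto
    \<comment> \<open>Swelling \<open>D i\<close> keeps the nerve as long as it avoids all intersections of members that
      miss \<open>D i\<close>. The factor \<open>topspace X\<close> makes the empty \<open>J\<close> take care of \<open>D i = {}\<close>.\<close>
    define K where "K = (\<Union>J\<in>{J. J \<subseteq> M \<and> D i \<inter> (\<Inter>j\<in>J. D j) = {}}. topspace X \<inter> (\<Inter>j\<in>J. D j))"
    have clJ: "closedin X (topspace X \<inter> (\<Inter>j\<in>J. D j))" if "J \<subseteq> M" for J
    proof (cases "J = {}")
      case False
      then have "closedin X (\<Inter>j\<in>J. D j)" using that D by (intro closedin_INT) auto
      then show ?thesis by (simp add: closedin_Int)
    qed auto
    have "closedin X K"
      unfolding K_def using clJ M by (intro closedin_Union) (auto intro: finite_subset[of _ "(\<lambda>J. topspace X \<inter> (\<Inter>j\<in>J. D j)) ` Pow M"])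
    moreover have "disjnt (D i) K"
      by (auto simp: K_def disjnt_def)
    ultimately obtain W W' where W: "openin X W" "openin X W'" "D i \<subseteq> W" "K \<subseteq> W'" "disjnt W W'"
      using X D[OF i(1)] unfolding normal_space_def by metis
    \<comment> \<open>\<open>E\<close> contains \<open>W\<close> because \<open>W\<close> and
      \<open>W'\<close> are disjoint, and misses \<open>K\<close> because \<open>K\<close> lies in
      \<open>W'\<close>; so \<open>W\<close> and \<open>E\<close> serve as the new
      \<open>V i\<close> and \<open>D i\<close>.\<close>
    define E where "E = topspace X - W'"
    have E: "closedin X E" "W \<subseteq> E" "E \<inter> K = {}"
      using W openin_subset[OF W(1)] by (auto simp: E_def disjnt_def)
    define V' D' where "V' = V(i := W)" and "D' = D(i := E)"
    have "(\<Inter>j\<in>J. C j) \<noteq> {}" if J: "J \<subseteq> M" and ne: "(\<Inter>j\<in>J. D' j) \<noteq> {}" for J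
    proof (cases "i \<in> J")
      case True
      obtain x where x: "\<And>j. j \<in> J \<Longrightarrow> x \<in> D' j" using ne by auto
      have xE: "x \<in> E" using x[OF True] by (simp add: D'_def)
      then have xX: "x \<in> topspace X" using closedin_subset[OF E(1)] by blast
      have xJ: "x \<in> (\<Inter>j\<in>J-{i}. D j)"
      proof
        fix j assume "j \<in> J - {i}"
        then show "x \<in> D j" using x[of j] by (simp add: D'_def)
      qed
      \<comment> \<open>Otherwise \<open>J - {i}\<close> is one of the families collected in
        \<open>K\<close>, which puts \<open>x\<close> in \<open>K\<close> although \<open>E\<close>
        avoids \<open>K\<close>. Hence the old sets already meet and the old nerve condition applies
        to \<open>J\<close>.\<close>
      have "D i \<inter> (\<Inter>j\<in>J-{i}. D j) \<noteq> {}"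
      proof
        assume "D i \<inter> (\<Inter>j\<in>J-{i}. D j) = {}"
        then have "J - {i} \<in> {J. J \<subseteq> M \<and> D i \<inter> (\<Inter>j\<in>J. D j) = {}}" using J by blast
        then have "x \<in> K" unfolding K_def by (rule UN_I) (use xX xJ in blast)
        with xE E(3) show False by blast
      qed
      moreover have "D i \<inter> (\<Inter>j\<in>J-{i}. D j) = (\<Inter>j\<in>J. D j)" using True by blast
      ultimately show ?thesis using nerve J by metis
    next
      case False
      then have "(\<Inter>j\<in>J. D' j) = (\<Inter>j\<in>J. D j)" by (auto simp: D'_def)
      then show ?thesis using nerve J ne by metis
    qed
    moreover have "C i \<subseteq> W" using D[OF i(1)] W(3) by blast
    then have "\<forall>j\<in>insert i I. openin X (V' j) \<and> C j \<subseteq> V' j \<and> V' j \<subseteq> D' j"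
      using VD i(2) W(1) E(2) by (simp add: V'_def D'_def)
    moreover have "\<forall>j\<in>M. closedin X (D' j) \<and> C j \<subseteq> D' j"
      using D E(1) order_trans[OF \<open>C i \<subseteq> W\<close> E(2)] by (simp add: D'_def)
    ultimately show ?case by blast
  qed
  from this[OF M order_refl] obtain V D
    where "\<forall>i\<in>M. openin X (V i) \<and> C i \<subseteq> V i \<and> V i \<subseteq> D i"
      and "\<forall>i\<in>M. closedin X (D i) \<and> C i \<subseteq> D i"
      and nerve: "\<forall>J\<subseteq>M. (\<Inter>j\<in>J. D j) \<noteq> {} \<longrightarrow> (\<Inter>j\<in>J. C j) \<noteq> {}"
    by (elim exE conjE) (rule that)
  then show thesis by (intro that[OF _ nerve]) simp
qed

lemma is_cover_open_enlarge:
  assumes "is_cover kind m X C" "\<And>i. i \<le> m \<Longrightarrow> openin X (U i)" "\<And>i. i \<le> m \<Longrightarrow> C i \<subseteq> U i"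
  shows "is_cover Open_Cover m X U"
proof -
  have "topspace X = (\<Union>i\<le>m. C i)" using assms(1) by (simp add: is_cover_def)
  also have "\<dots> \<subseteq> (\<Union>i\<le>m. U i)" using assms(3) by (intro UN_mono) auto
  finally have "topspace X \<subseteq> (\<Union>i\<le>m. U i)" .
  moreover have "(\<Union>i\<le>m. U i) \<subseteq> topspace X" using assms(2) by (intro UN_least openin_subset) auto
  ultimately show ?thesis using assms(2) by (simp add: is_cover_def subset_antisym)
qed

text \<open>Since \<open>C i \<subseteq> U i \<subseteq> D i\<close>, the nerve of \<open>U\<close>
  lies between those of \<open>C\<close> and \<open>D\<close>, and these two agree.\<close>

lemma closed_cover_swelling:
  assumes X: "normal_space X" and C: "is_cover Closed_Cover m X C"
  obtains U where "is_cover Open_Cover m X U" "\<And>i. i \<le> m \<Longrightarrow> C i \<subseteq> U i"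
    "\<And>J. J \<subseteq> {..m} \<Longrightarrow> (\<Inter>j\<in>J. U j) \<noteq> {} \<longleftrightarrow> (\<Inter>j\<in>J. C j) \<noteq> {}"
proof -
  have "closedin X (C i)" if "i \<in> {..m}" for i using C that by (simp add: is_cover_def)
  from closed_family_swelling[OF X finite_atMost this] obtain U D
    where "\<forall>i\<in>{..m}. openin X (U i) \<and> closedin X (D i) \<and> C i \<subseteq> U i \<and> U i \<subseteq> D i"
      and "\<forall>J\<subseteq>{..m}. (\<Inter>j\<in>J. D j) \<noteq> {} \<longrightarrow> (\<Inter>j\<in>J. C j) \<noteq> {}" .
  then have UD: "\<And>i. i \<le> m \<Longrightarrow> openin X (U i) \<and> C i \<subseteq> U i \<and> U i \<subseteq> D i"
    and nerve: "\<And>J. J \<subseteq> {..m} \<Longrightarrow> (\<Inter>j\<in>J. D j) \<noteq> {} \<Longrightarrow> (\<Inter>j\<in>J. C j) \<noteq> {}"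
    by simp_all
  show ?thesis
  proof
    show "is_cover Open_Cover m X U" using is_cover_open_enlarge[OF C] UD by blast
    show "(\<Inter>j\<in>J. U j) \<noteq> {} \<longleftrightarrow> (\<Inter>j\<in>J. C j) \<noteq> {}" if J: "J \<subseteq> {..m}" for J
    proof
      assume "(\<Inter>j\<in>J. U j) \<noteq> {}"
      moreover have "(\<Inter>j\<in>J. U j) \<subseteq> (\<Inter>j\<in>J. D j)" using UD J by (intro INF_mono) blast
      ultimately show "(\<Inter>j\<in>J. C j) \<noteq> {}" using nerve[OF J] by blast
    next
      assume "(\<Inter>j\<in>J. C j) \<noteq> {}"
      moreover have "(\<Inter>j\<in>J. C j) \<subseteq> (\<Inter>j\<in>J. U j)" using UD J by (intro INF_mono) blast
      ultimately show "(\<Inter>j\<in>J. U j) \<noteq> {}" by blast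
    qed
  qed (use UD in auto)
qed

text \<open>Swelling is applied to the complements \<open>C i\<close>, which have empty total
  intersection because \<open>U\<close> covers. The swollen sets \<open>D i\<close> inherit this, so
  their complements cover; the complement of \<open>V i\<close> is closed, contains that of
  \<open>D i\<close> and lies in \<open>U i\<close>.\<close>

lemma open_cover_shrinking:
  assumes X: "normal_space X" and U: "is_cover Open_Cover m X U"
  obtains W where "is_cover Open_Cover m X W" "\<And>i. i \<le> m \<Longrightarrow> X closure_of W i \<subseteq> U i"
proof -
  define C where "C = (\<lambda>i. topspace X - U i)"
  have "closedin X (C i)" if "i \<in> {..m}" for i using U that by (auto simp: C_def is_cover_def)
  from closed_family_swelling[OF X finite_atMost this] obtain V D
    where "\<forall>i\<in>{..m}. openin X (V i) \<and> closedin X (D i) \<and> C i \<subseteq> V i \<and> V i \<subseteq> D i"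
      and "\<forall>J\<subseteq>{..m}. (\<Inter>j\<in>J. D j) \<noteq> {} \<longrightarrow> (\<Inter>j\<in>J. C j) \<noteq> {}" .
  then have VD: "\<And>i. i \<le> m \<Longrightarrow> openin X (V i) \<and> closedin X (D i) \<and> C i \<subseteq> V i \<and> V i \<subseteq> D i"
    and nerve: "\<And>J. J \<subseteq> {..m} \<Longrightarrow> (\<Inter>j\<in>J. D j) \<noteq> {} \<Longrightarrow> (\<Inter>j\<in>J. C j) \<noteq> {}"
    by simp_all
  have "(\<Inter>j\<le>m. C j) = {}"
    using U by (auto simp: C_def is_cover_def)
  then have D: "(\<Inter>j\<le>m. D j) = {}" using nerve by blast
  show ?thesis
  proof
    show "is_cover Open_Cover m X (\<lambda>i. topspace X - D i)"
      using VD D by (auto simp: is_cover_def)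
    show "X closure_of (topspace X - D i) \<subseteq> U i" if "i \<le> m" for i
    proof -
      have "X closure_of (topspace X - D i) \<subseteq> topspace X - V i"
        using VD[OF that] by (intro closure_of_minimal) auto
      then show ?thesis using VD[OF that] by (auto simp: C_def)
    qed
  qed
qed

text \<open>Two shrinkings leave room on both sides: Urysohn functions equal to 1 on the closure of
  \<open>W' i\<close> and to 0 off \<open>W i\<close> have a positive sum since \<open>W'\<close>
  covers, and their supports lie in the closure of \<open>W i\<close>, hence in
  \<open>U i\<close>.\<close>

lemma exists_subordinate_partition:
  assumes X: "normal_space X" and U: "is_cover Open_Cover m X U"
  obtains \<phi> where "subordinate_partition m X U \<phi>"
proof -
  obtain W where W: "is_cover Open_Cover m X W" "\<And>i. i \<le> m \<Longrightarrow> X closure_of W i \<subseteq> U i"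
    using open_cover_shrinking[OF X U] by blast
  obtain W' where W': "is_cover Open_Cover m X W'" "\<And>i. i \<le> m \<Longrightarrow> X closure_of W' i \<subseteq> W i"
    using open_cover_shrinking[OF X W(1)] by blast
  have "\<exists>f. continuous_map X (top_of_set {0..1::real}) f \<and>
            f ` (topspace X - W i) \<subseteq> {0} \<and> f ` (X closure_of W' i) \<subseteq> {1}" if "i \<le> m" for i
  proof -
    have "closedin X (topspace X - W i)" "disjnt (topspace X - W i) (X closure_of W' i)"
      using that W(1) W'(2)[OF that] by (auto simp: is_cover_def disjnt_def)
    then show ?thesis using Urysohn_lemma[OF X _ closedin_closure_of, of _ _ 0 1] by (metis zero_le_one)
  qed
  then obtain f where "\<And>i. i \<le> m \<Longrightarrow> continuous_map X (top_of_set {0..1::real}) (f i) \<and>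
      f i ` (topspace X - W i) \<subseteq> {0} \<and> f i ` (X closure_of W' i) \<subseteq> {1}"
    by metis
  then have f: "\<And>i. i \<le> m \<Longrightarrow> continuous_map X (top_of_set {0..1::real}) (f i)"
    and f0: "\<And>i x. i \<le> m \<Longrightarrow> x \<in> topspace X - W i \<Longrightarrow> f i x = 0"
    and f1: "\<And>i x. i \<le> m \<Longrightarrow> x \<in> X closure_of W' i \<Longrightarrow> f i x = 1"
    by blast+
  have fc: "continuous_map X euclideanreal (f i)" if "i \<le> m" for i
    using f[OF that] by (simp add: continuous_map_in_subtopology)
  have fpos: "0 \<le> f i x" if "i \<le> m" "x \<in> topspace X" for i x
    using f[OF that(1)] that(2) by (force simp: continuous_map_in_subtopology)
  define s where "s x = (\<Sum>i\<le>m. f i x)" for x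
  have s: "0 < s x" if x: "x \<in> topspace X" for x
  proof -
    obtain i where i: "i \<le> m" "x \<in> W' i" using x W'(1) by (auto simp: is_cover_def)
    then have "x \<in> X closure_of W' i"
      using x by (metis Int_iff closure_of_subset_Int subsetD)
    then have "f i x = 1" using f1 i by blast
    then show ?thesis unfolding s_def
      using fpos x i by (intro sum_pos2[of _ i]) auto
  qed
  have "subordinate_partition m X U (\<lambda>i x. f i x / s x)"
    unfolding subordinate_partition_def
  proof (intro conjI allI impI ballI)
    fix i assume i: "i \<le> m"
    show "continuous_map X euclideanreal (\<lambda>x. f i x / s x)"
      unfolding s_def using fc i s
      by (intro continuous_map_real_divide continuous_map_sum) (auto simp: s_def dest: s)
    show "0 \<le> f i x / s x" if "x \<in> topspace X" for x
      using fpos[OF i that] s[OF that] by simp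
    have "{x \<in> topspace X. f i x / s x \<noteq> 0} \<subseteq> W i" using f0[OF i] by auto
    then show "X closure_of {x \<in> topspace X. f i x / s x \<noteq> 0} \<subseteq> U i"
      using W(2)[OF i] by (meson closure_of_mono order_trans)
  next
    fix x assume "x \<in> topspace X"
    then show "(\<Sum>i\<le>m. f i x / s x) = 1"
      using s[of x] by (simp add: s_def flip: sum_divide_distrib)
  qed
  then show ?thesis by (rule that)
qed

lemma subordinate_partition_mono:
  assumes "subordinate_partition m X U \<phi>" "\<And>i. i \<le> m \<Longrightarrow> U i \<subseteq> U' i"
  shows "subordinate_partition m X U' \<phi>"
  using assms unfolding subordinate_partition_def by (meson order_trans)

text \<open>The closure in a subspace lies inside the closure in the whole space, so supports stay
  in the traces of \<open>U\<close>.\<close>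

lemma subordinate_partition_subtopology:
  assumes "subordinate_partition m X U \<phi>"
  shows "subordinate_partition m (subtopology X A) (\<lambda>i. U i \<inter> A) \<phi>"
proof -
  have "subtopology X A closure_of {x \<in> topspace (subtopology X A). \<phi> i x \<noteq> 0} \<subseteq> U i \<inter> A"
    if "i \<le> m" for i
  proof -
    have "A \<inter> {x \<in> topspace (subtopology X A). \<phi> i x \<noteq> 0} \<subseteq> {x \<in> topspace X. \<phi> i x \<noteq> 0}" by auto
    then show ?thesis
      using assms that unfolding subordinate_partition_def closure_of_subtopology
      by (meson Int_greatest Int_lower1 closure_of_mono inf.coboundedI2 order_trans)
  qed
  then show ?thesis
    using assms by (auto simp: subordinate_partition_def continuous_map_from_subtopology)
qed

lemma subordinate_partition_zero:
  assumes "subordinate_partition m X U \<phi>" "x \<in> topspace X" "i \<le> m" "x \<notin> U i"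
  shows "\<phi> i x = 0"
proof (rule ccontr)
  assume "\<phi> i x \<noteq> 0"
  then have "x \<in> X closure_of {x \<in> topspace X. \<phi> i x \<noteq> 0}"
    using assms(2) closure_of_subset[of "{x \<in> topspace X. \<phi> i x \<noteq> 0}" X] by auto
  then show False using assms by (auto simp: subordinate_partition_def)
qed

section \<open>Barycentric coordinates on the boundary of a simplex\<close>

text \<open>Barycentric coordinates have to be recovered continuously from a point of the simplex.
  The differences from \<open>v i\<close> are independent, so some linear functional takes the value
  -1 on all of them; shifted by 1 it gives an affine function with value 1 at \<open>v i\<close> and
  0 at the other vertices.\<close>

lemma simplex_affine_coordinates:
  fixes v :: "nat \<Rightarrow> 'c::euclidean_space"
  assumes v: "simplex_vertices m v"
  obtains \<beta> :: "nat \<Rightarrow> 'c \<Rightarrow> real" where "\<And>i. continuous_on UNIV (\<beta> i)"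
    "\<And>i c. i \<le> m \<Longrightarrow> (\<Sum>j\<le>m. c j) = 1 \<Longrightarrow> \<beta> i (\<Sum>j\<le>m. c j *\<^sub>R v j) = c i"
proof -
  have inj: "inj_on v {..m}" and ind: "\<not> affine_dependent (v ` {..m})"
    using v by (auto simp: simplex_vertices_def)
  have "\<exists>g :: 'c \<Rightarrow> real. linear g \<and> (\<forall>j\<le>m. j \<noteq> i \<longrightarrow> g (v j - v i) = -1)" if i: "i \<le> m" for i
  proof -
    have "independent ((\<lambda>x. - v i + x) ` (v ` {..m} - {v i}))"
      using affine_dependent_iff_dependent2[of "v i" "v ` {..m}"] i ind by auto
    from linear_independent_extend[OF this, of "\<lambda>_. - 1 :: real"]
    obtain g :: "'c \<Rightarrow> real" where g: "linear g"
      "\<And>x. x \<in> (\<lambda>x. - v i + x) ` (v ` {..m} - {v i}) \<Longrightarrow> g x = - 1"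
      by blast
    have "g (v j - v i) = -1" if "j \<le> m" "j \<noteq> i" for j
    proof (rule g(2))
      have "v j \<noteq> v i" using inj i that by (auto dest: inj_onD)
      then show "v j - v i \<in> (\<lambda>x. - v i + x) ` (v ` {..m} - {v i})"
        using that by (intro image_eqI[of _ _ "v j"]) auto
    qed
    then show ?thesis using g(1) by blast
  qed
  then obtain g :: "nat \<Rightarrow> 'c \<Rightarrow> real" where lin: "\<And>i. i \<le> m \<Longrightarrow> linear (g i)"
    and g: "\<And>i j. i \<le> m \<Longrightarrow> j \<le> m \<Longrightarrow> j \<noteq> i \<Longrightarrow> g i (v j - v i) = -1"
    by metis
  define \<beta> where "\<beta> i x = (if i \<le> m then 1 + g i (x - v i) else 0)" for i x
  show ?thesis
  proof
    show "continuous_on UNIV (\<beta> i)" for i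
    proof (cases "i \<le> m")
      case True
      then have "\<beta> i = (\<lambda>x. 1 + g i (x - v i))" by (auto simp: \<beta>_def)
      moreover have "continuous_on UNIV (\<lambda>x. 1 + g i (x - v i))"
        using lin[OF True]
        by (intro continuous_intros linear_continuous_on_compose[of _ _ "g i"]) auto
      ultimately show ?thesis by simp
    next
      case False
      then have "\<beta> i = (\<lambda>x. 0)" by (auto simp: \<beta>_def)
      then show ?thesis by simp
    qed
    fix i and c :: "nat \<Rightarrow> real" assume i: "i \<le> m" and c: "(\<Sum>j\<le>m. c j) = 1"
    interpret linear "g i" by (rule lin[OF i])
    \<comment> \<open>As the weights sum to 1, subtracting \<open>v i\<close> turns the affine
      combination into a linear combination of differences.\<close>
    have "(\<Sum>j\<le>m. c j *\<^sub>R v j) - v i = (\<Sum>j\<le>m. c j *\<^sub>R (v j - v i))"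
      using c by (simp add: scaleR_diff_right sum_subtractf flip: scaleR_sum_left)
    then have "g i ((\<Sum>j\<le>m. c j *\<^sub>R v j) - v i) = (\<Sum>j\<le>m. c j * g i (v j - v i))"
      by (simp add: sum scaleR)
    also have "\<dots> = (\<Sum>j\<le>m. if j = i then 0 else - c j)"
      using g[OF i] by (intro sum.cong) (auto simp: zero)
    also have "\<dots> = (\<Sum>j\<in>{..m}-{i}. - c j)"
      using i by (subst sum.remove[of _ i]) (auto intro: sum.cong)
    also have "\<dots> = c i - 1" using c i by (simp add: sum_negf sum_diff1)
    finally show "\<beta> i (\<Sum>j\<le>m. c j *\<^sub>R v j) = c i" using i by (simp add: \<beta>_def)
  qed
qed

text \<open>The relative frontier is first described by weights on the set of vertices. Injectivity
  of \<open>v\<close> moves them to weights on indices, which is how partitions are indexed; a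
  vanishing weight marks a proper face.\<close>

lemma simplex_boundary_explicit:
  assumes v: "simplex_vertices m v"
  shows "simplex_boundary m v =
    {y. \<exists>c. (\<forall>i\<le>m. 0 \<le> c i) \<and> (\<exists>i\<le>m. c i = 0) \<and> (\<Sum>i\<le>m. c i) = 1 \<and> (\<Sum>i\<le>m. c i *\<^sub>R v i) = y}"
    (is "_ = ?R")
proof -
  have inj: "inj_on v {..m}" and ind: "\<not> affine_dependent (v ` {..m})"
    using v by (auto simp: simplex_vertices_def)
  show ?thesis
    unfolding simplex_boundary_def rel_frontier_convex_hull_explicit[OF ind]
  proof (intro equalityI subsetI)
    fix y assume "y \<in> {y. \<exists>u. (\<forall>x\<in>v ` {..m}. 0 \<le> u x) \<and> (\<exists>x\<in>v ` {..m}. u x = 0) \<and>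
          sum u (v ` {..m}) = 1 \<and> (\<Sum>x\<in>v ` {..m}. u x *\<^sub>R x) = y}"
    then obtain u where "\<forall>x\<in>v ` {..m}. 0 \<le> u x" "\<exists>x\<in>v ` {..m}. u x = 0"
      "sum u (v ` {..m}) = 1" "(\<Sum>x\<in>v ` {..m}. u x *\<^sub>R x) = y" by auto
    then show "y \<in> ?R"
      using inj by (auto simp: sum.reindex intro!: exI[of _ "u \<circ> v"])
  next
    fix y assume "y \<in> ?R"
    then obtain c where c: "\<forall>i\<le>m. 0 \<le> c i" "\<exists>i\<le>m. c i = 0" "(\<Sum>i\<le>m. c i) = 1"
      "(\<Sum>i\<le>m. c i *\<^sub>R v i) = y" by auto
    have "inv_into {..m} v (v i) = i" if "i \<le> m" for i using inj that by simp
    then show "y \<in> {y. \<exists>u. (\<forall>x\<in>v ` {..m}. 0 \<le> u x) \<and> (\<exists>x\<in>v ` {..m}. u x = 0) \<and>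
          sum u (v ` {..m}) = 1 \<and> (\<Sum>x\<in>v ` {..m}. u x *\<^sub>R x) = y}"
      using inj c by (auto simp: sum.reindex intro!: exI[of _ "c \<circ> inv_into {..m} v"])
  qed
qed

text \<open>A map to the simplex boundary, stored as its coordinate functions: the vanishing
  coordinate is what excludes the interior. Neither a cover nor vertices are mentioned, so the same
  notion serves on the sphere, on the ball and on the cylinder of a homotopy.\<close>

definition boundary_coordinates :: "nat \<Rightarrow> 'a topology \<Rightarrow> (nat \<Rightarrow> 'a \<Rightarrow> real) \<Rightarrow> bool" where
  "boundary_coordinates m X \<phi> \<longleftrightarrow>
     (\<forall>i\<le>m. continuous_map X euclideanreal (\<phi> i)) \<and>
     (\<forall>x\<in>topspace X. (\<forall>i\<le>m. 0 \<le> \<phi> i x) \<and> (\<exists>i\<le>m. \<phi> i x = 0) \<and> (\<Sum>i\<le>m. \<phi> i x) = 1)"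

text \<open>The empty intersection supplies at each point an index \<open>i\<close> with the point
  outside \<open>U i\<close>, and the support condition kills that coordinate.\<close>

lemma subordinate_partition_boundary_coordinates:
  assumes "subordinate_partition m X U \<phi>" "(\<Inter>i\<le>m. U i) = {}"
  shows "boundary_coordinates m X \<phi>"
  unfolding boundary_coordinates_def
proof (intro conjI ballI)
  fix x assume x: "x \<in> topspace X"
  obtain i where "i \<le> m" "x \<notin> U i" using assms(2) by auto
  then show "\<exists>i\<le>m. \<phi> i x = 0" using subordinate_partition_zero[OF assms(1) x] by blast
qed (use assms(1) in \<open>auto simp: subordinate_partition_def\<close>)

lemma continuous_map_simplex_boundary:
  assumes v: "simplex_vertices m v" and \<phi>: "boundary_coordinates m X \<phi>"
  shows "continuous_map X (top_of_set (simplex_boundary m v)) (\<lambda>x. \<Sum>i\<le>m. \<phi> i x *\<^sub>R v i)"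
proof -
  have "continuous_map X euclidean (\<lambda>x. \<phi> i x *\<^sub>R v i)" if "i \<le> m" for i
  proof -
    have "continuous_map X euclidean ((\<lambda>t. t *\<^sub>R v i) \<circ> \<phi> i)"
      using \<phi> that by (intro continuous_map_compose[of _ euclideanreal])
        (auto simp: boundary_coordinates_def intro!: continuous_intros)
    then show ?thesis by (simp add: o_def)
  qed
  moreover have "(\<Sum>i\<le>m. \<phi> i x *\<^sub>R v i) \<in> simplex_boundary m v" if "x \<in> topspace X" for x
    using \<phi> that unfolding simplex_boundary_explicit[OF v] boundary_coordinates_def
    by (intro CollectI exI[of _ "\<lambda>i. \<phi> i x"]) auto
  ultimately show ?thesis
    by (auto simp: continuous_map_in_subtopology intro!: continuous_map_sum)
qed

section \<open>Homotopy classes of covers\<close>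

lemma homotopy_class_eqI:
  assumes "homotopic_with (\<lambda>_. True) X Y f g"
  shows "homotopy_class X Y f = homotopy_class X Y g"
  unfolding homotopy_class_def
  using homotopic_with_trans[OF assms] homotopic_with_trans[OF homotopic_with_symD[OF assms]]
  by blast

lemma null_class_homotopy_class:
  assumes "continuous_map X Y f"
  shows "null_class X Y (homotopy_class X Y f) \<longleftrightarrow>
    (\<exists>y\<in>topspace Y. homotopic_with (\<lambda>_. True) X Y f (\<lambda>_. y))"
proof -
  have "homotopy_class X Y f = homotopy_class X Y (\<lambda>_. y) \<longleftrightarrow>
      homotopic_with (\<lambda>_. True) X Y f (\<lambda>_. y)" for y
  proof
    assume "homotopy_class X Y f = homotopy_class X Y (\<lambda>_. y)"
    \<comment> \<open>\<open>f\<close> lies in its own class because it is continuous: homotopy is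
      reflexive on continuous maps.\<close>
    then have "f \<in> homotopy_class X Y (\<lambda>_. y)"
      using assms by (metis homotopy_class_def homotopic_with_refl mem_Collect_eq)
    then show "homotopic_with (\<lambda>_. True) X Y f (\<lambda>_. y)"
      by (simp add: homotopy_class_def homotopic_with_sym)
  qed (rule homotopy_class_eqI)
  then show ?thesis by (simp add: null_class_def)
qed

text \<open>
  At every point some index is missing from the cover, and both partitions vanish there, so the
  segment between the two points stays in the boundary.
\<close>

lemma homotopy_class_subordinate_unique:
  fixes \<phi> :: "nat \<Rightarrow> 'a \<Rightarrow> real"
  assumes v: "simplex_vertices m v"
    and h: "continuous_map (top_of_set (simplex_boundary m v)) Y h"
    and U: "(\<Inter>i\<le>m. U i) = {}"
    and \<phi>: "subordinate_partition m X U \<phi>" and \<psi>: "subordinate_partition m X U \<psi>"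
  shows "homotopy_class X Y (\<lambda>x. h (\<Sum>i\<le>m. \<phi> i x *\<^sub>R v i)) =
         homotopy_class X Y (\<lambda>x. h (\<Sum>i\<le>m. \<psi> i x *\<^sub>R v i))"
proof -
  define \<theta> where "\<theta> i p = (1 - fst p) * \<phi> i (snd p) + fst p * \<psi> i (snd p)" for i and p :: "real \<times> 'a"
  have "boundary_coordinates m (prod_topology (top_of_set {0..1}) X) \<theta>"
    unfolding boundary_coordinates_def
  proof (intro conjI ballI allI impI)
    fix i assume i: "i \<le> m"
    have "continuous_map X euclideanreal (\<phi> i)" "continuous_map X euclideanreal (\<psi> i)"
      using i \<phi> \<psi> by (auto simp: subordinate_partition_def)
    moreover have "continuous_map (prod_topology (top_of_set {0..1::real}) X) euclideanreal fst"
      by (metis continuous_map_fst continuous_map_in_subtopology)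
    ultimately show "continuous_map (prod_topology (top_of_set {0..1}) X) euclideanreal (\<theta> i)"
      unfolding \<theta>_def
      by (intro continuous_intros continuous_map_compose[OF continuous_map_snd, unfolded o_def])
  next
    fix p assume p: "p \<in> topspace (prod_topology (top_of_set {0..1::real}) X)"
    then have x: "snd p \<in> topspace X" and t: "0 \<le> fst p" "fst p \<le> 1" by auto
    show "0 \<le> \<theta> i p" if "i \<le> m" for i
      using x t that \<phi> \<psi> by (simp add: \<theta>_def subordinate_partition_def)
    obtain i where i: "i \<le> m" "snd p \<notin> U i" using U by auto
    then have "\<theta> i p = 0"
      using x \<phi> \<psi> by (simp add: \<theta>_def subordinate_partition_zero)
    with i show "\<exists>i\<le>m. \<theta> i p = 0" by blast
    show "(\<Sum>i\<le>m. \<theta> i p) = 1"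
      using x \<phi> \<psi> by (simp add: \<theta>_def subordinate_partition_def sum.distrib flip: sum_distrib_left)
  qed
  note cont = continuous_map_compose[OF continuous_map_simplex_boundary[OF v this] h]
  have "homotopic_with (\<lambda>_. True) X Y (\<lambda>x. h (\<Sum>i\<le>m. \<phi> i x *\<^sub>R v i)) (\<lambda>x. h (\<Sum>i\<le>m. \<psi> i x *\<^sub>R v i))"
    unfolding homotopic_with_def by (rule exI, intro conjI, rule cont) (auto simp: \<theta>_def)
  then show ?thesis by (rule homotopy_class_eqI)
qed

text \<open>Independence of the partition makes all candidates in the definite description equal, so
  any one partition evaluates it.\<close>

lemma open_cover_class_eq:
  fixes h :: "'c::euclidean_space \<Rightarrow> 'b::euclidean_space"
  assumes v: "simplex_vertices m v"
    and h: "continuous_map (top_of_set (simplex_boundary m v)) (top_of_set (sphere 0 1)) h"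
    and U: "(\<Inter>i\<le>m. U i) = {}" and \<phi>: "subordinate_partition m X U \<phi>"
  shows "open_cover_class m v h X U =
    homotopy_class X (top_of_set (sphere 0 1)) (\<lambda>x. h (\<Sum>i\<le>m. \<phi> i x *\<^sub>R v i))"
  unfolding open_cover_class_def
  using \<phi> homotopy_class_subordinate_unique[OF v h U _ \<phi>] by (intro the_equality) blast+

text \<open>
  Two open covers \<open>U\<close> and \<open>U'\<close> admissible for \<open>C\<close> have the common refinement \<open>U \<inter> U'\<close>, and a
  partition subordinate to it computes the class of both.
\<close>

lemma closed_cover_class_eq:
  fixes h :: "'c::euclidean_space \<Rightarrow> 'b::euclidean_space"
  assumes X: "normal_space X" and v: "simplex_vertices m v"
    and h: "continuous_map (top_of_set (simplex_boundary m v)) (top_of_set (sphere 0 1)) h"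
    and C: "is_cover Closed_Cover m X C" and C0: "(\<Inter>i\<le>m. C i) = {}"
    and U: "is_cover Open_Cover m X U" and CU: "\<And>i. i \<le> m \<Longrightarrow> C i \<subseteq> U i"
    and U0: "(\<Inter>i\<le>m. U i) = {}" and \<phi>: "subordinate_partition m X U \<phi>"
  shows "closed_cover_class m v h X C =
    homotopy_class X (top_of_set (sphere 0 1)) (\<lambda>x. h (\<Sum>i\<le>m. \<phi> i x *\<^sub>R v i))"
proof -
  have eq: "open_cover_class m v h X V =
      homotopy_class X (top_of_set (sphere 0 1)) (\<lambda>x. h (\<Sum>i\<le>m. \<phi> i x *\<^sub>R v i))"
    if V: "is_cover Open_Cover m X V" "\<forall>i\<le>m. C i \<subseteq> V i" and V0: "(\<Inter>i\<le>m. V i) = {}" for V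
  proof -
    have "is_cover Open_Cover m X (\<lambda>i. U i \<inter> V i)"
      using U V CU by (intro is_cover_open_enlarge[OF C]) (auto simp: is_cover_def)
    then obtain \<psi> where "subordinate_partition m X (\<lambda>i. U i \<inter> V i) \<psi>"
      using exists_subordinate_partition[OF X] by blast
    then have \<psi>: "subordinate_partition m X U \<psi>" "subordinate_partition m X V \<psi>"
      by (auto elim: subordinate_partition_mono)
    show ?thesis
      using open_cover_class_eq[OF v h V0 \<psi>(2)]
        homotopy_class_subordinate_unique[OF v h U0 \<phi> \<psi>(1)] by simp
  qed
  obtain V where V: "is_cover Open_Cover m X V" "\<And>i. i \<le> m \<Longrightarrow> C i \<subseteq> V i"
    "\<And>J. J \<subseteq> {..m} \<Longrightarrow> (\<Inter>j\<in>J. V j) \<noteq> {} \<longleftrightarrow> (\<Inter>j\<in>J. C j) \<noteq> {}"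
    using closed_cover_swelling[OF X C] by blast
  show ?thesis
    unfolding closed_cover_class_def
  proof (rule the_equality)
    \<comment> \<open>The nerve condition at \<open>J = {..m}\<close> transfers the empty
      intersection from \<open>C\<close> to \<open>V\<close>, so that \<open>eq\<close>
      applies.\<close>
    have "(\<Inter>i\<le>m. V i) = {}" using V(3)[OF order_refl] C0 by blast
    then show "\<exists>U. is_cover Open_Cover m X U \<and> (\<forall>i\<le>m. C i \<subseteq> U i) \<and>
        (\<forall>J\<subseteq>{..m}. ((\<Inter>j\<in>J. U j) \<noteq> {}) = ((\<Inter>j\<in>J. C j) \<noteq> {})) \<and>
        homotopy_class X (top_of_set (sphere 0 1)) (\<lambda>x. h (\<Sum>i\<le>m. \<phi> i x *\<^sub>R v i)) =
        open_cover_class m v h X U"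
      using V eq by (intro exI[of _ V]) simp
    fix c
    assume "\<exists>U. is_cover Open_Cover m X U \<and> (\<forall>i\<le>m. C i \<subseteq> U i) \<and>
        (\<forall>J\<subseteq>{..m}. ((\<Inter>j\<in>J. U j) \<noteq> {}) = ((\<Inter>j\<in>J. C j) \<noteq> {})) \<and>
        c = open_cover_class m v h X U"
    then obtain W where W: "is_cover Open_Cover m X W" "\<forall>i\<le>m. C i \<subseteq> W i"
      "\<forall>J\<subseteq>{..m}. ((\<Inter>j\<in>J. W j) \<noteq> {}) = ((\<Inter>j\<in>J. C j) \<noteq> {})" "c = open_cover_class m v h X W"
      by blast
    have "(\<Inter>i\<le>m. W i) = {}" using W(3) C0 by blast
    then show "c = homotopy_class X (top_of_set (sphere 0 1)) (\<lambda>x. h (\<Sum>i\<le>m. \<phi> i x *\<^sub>R v i))"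
      using eq W by simp
  qed
qed

text \<open>A map on the sphere is null-homotopic iff it extends to the ball with values in
  \<open>Y\<close>. Such an extension becomes one of coordinates through the inverse of
  \<open>h\<close> and the affine coordinate functions, and coordinates become a map to
  \<open>Y\<close> through \<open>h\<close>.\<close>

lemma null_class_iff_coordinates_extend:
  fixes \<phi> :: "nat \<Rightarrow> 'a::euclidean_space \<Rightarrow> real" and Y :: "'b::real_normed_vector set"
  assumes v: "simplex_vertices m v"
    and h: "homeomorphic_map (top_of_set (simplex_boundary m v)) (top_of_set Y) h"
    and \<phi>: "boundary_coordinates m (top_of_set (sphere 0 1)) \<phi>"
  shows "null_class (top_of_set (sphere 0 1)) (top_of_set Y)
      (homotopy_class (top_of_set (sphere 0 1)) (top_of_set Y) (\<lambda>x. h (\<Sum>i\<le>m. \<phi> i x *\<^sub>R v i))) \<longleftrightarrow>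
    (\<exists>g. boundary_coordinates m (top_of_set (cball 0 1)) g \<and>
         (\<forall>i\<le>m. \<forall>x\<in>sphere 0 1. g i x = \<phi> i x))"
proof -
  let ?f = "\<lambda>x. h (\<Sum>i\<le>m. \<phi> i x *\<^sub>R v i)"
  have hc: "continuous_map (top_of_set (simplex_boundary m v)) (top_of_set Y) h"
    using h homeomorphic_imp_continuous_map by blast
  have f: "continuous_map (top_of_set (sphere 0 1)) (top_of_set Y) ?f"
    using continuous_map_compose[OF continuous_map_simplex_boundary[OF v \<phi>] hc] by (simp add: o_def)
  \<comment> \<open>The sphere has points, so the constant at the end of a homotopy automatically
    lies in \<open>Y\<close>; the extension theorem used below leaves that constant
    unrestricted.\<close>
  have ne: "sphere (0::'a) 1 \<noteq> {}" by simp
  have "(\<exists>y\<in>Y. homotopic_with_canon (\<lambda>_. True) (sphere 0 1) Y ?f (\<lambda>_. y)) \<longleftrightarrow>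
    (\<exists>y. homotopic_with_canon (\<lambda>_. True) (sphere 0 1) Y ?f (\<lambda>_. y))"
    using ne by (blast dest: homotopic_with_imp_subset2)
  then have "null_class (top_of_set (sphere 0 1)) (top_of_set Y)
      (homotopy_class (top_of_set (sphere 0 1)) (top_of_set Y) ?f) \<longleftrightarrow>
    (\<exists>G. continuous_on (cball 0 1) G \<and> G ` cball 0 1 \<subseteq> Y \<and> (\<forall>x\<in>sphere 0 1. G x = ?f x))"
    unfolding null_class_homotopy_class[OF f] by (simp add: nullhomotopic_from_sphere_extension)
  also have "\<dots> \<longleftrightarrow> (\<exists>g. boundary_coordinates m (top_of_set (cball 0 1)) g \<and>
         (\<forall>i\<le>m. \<forall>x\<in>sphere 0 1. g i x = \<phi> i x))" (is "?L \<longleftrightarrow> ?R")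
  proof
    assume ?L
    then obtain G where G: "continuous_on (cball 0 1) G" "G ` cball 0 1 \<subseteq> Y"
      "\<And>x. x \<in> sphere 0 1 \<Longrightarrow> G x = ?f x" by blast
    obtain h' where h': "continuous_on Y h'" "h' ` Y \<subseteq> simplex_boundary m v"
      "\<And>x. x \<in> simplex_boundary m v \<Longrightarrow> h' (h x) = x"
      using h by (auto simp: homeomorphic_map_maps homeomorphic_maps_def)
    obtain \<beta> where \<beta>: "\<And>i. continuous_on UNIV (\<beta> i)"
      "\<And>i c. i \<le> m \<Longrightarrow> (\<Sum>j\<le>m. c j) = 1 \<Longrightarrow> \<beta> i (\<Sum>j\<le>m. c j *\<^sub>R v j) = c i"
      using simplex_affine_coordinates[OF v] by blast
    define g where "g i x = \<beta> i (h' (G x))" for i x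
    have "continuous_on (cball 0 1) (g i)" for i
      unfolding g_def using G h' \<beta>
      by (intro continuous_on_compose2[OF \<beta>(1)] continuous_on_compose2[OF h'(1) G(1)]) auto
    moreover have "(\<forall>i\<le>m. 0 \<le> g i x) \<and> (\<exists>i\<le>m. g i x = 0) \<and> (\<Sum>i\<le>m. g i x) = 1"
      if "x \<in> cball 0 1" for x
    proof -
      \<comment> \<open>The point \<open>h' (G x)\<close> has some boundary weights
        \<open>c\<close>; the functions \<open>\<beta> i\<close> read them off, so \<open>g\<close>
        inherits their signs, their zero and their sum.\<close>
      have "h' (G x) \<in> simplex_boundary m v" using G h' that by blast
      then obtain c where c: "\<forall>i\<le>m. 0 \<le> c i" "\<exists>i\<le>m. c i = 0" "(\<Sum>i\<le>m. c i) = 1"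
        "(\<Sum>i\<le>m. c i *\<^sub>R v i) = h' (G x)"
        unfolding simplex_boundary_explicit[OF v] by blast
      have "g i x = c i" if "i \<le> m" for i
        using \<beta>(2)[OF that c(3)] c(4) by (simp add: g_def)
      then show ?thesis using c by (metis (no_types, lifting) atMost_iff sum.cong)
    qed
    moreover have "g i x = \<phi> i x" if "i \<le> m" "x \<in> sphere 0 1" for i x
    proof -
      have "(\<Sum>i\<le>m. \<phi> i x *\<^sub>R v i) \<in> simplex_boundary m v"
        using continuous_map_simplex_boundary[OF v \<phi>] that(2) by (auto simp: continuous_map_def)
      then show ?thesis
        using G(3)[OF that(2)] h'(3) \<beta>(2)[OF that(1)] \<phi> that
        by (simp add: g_def boundary_coordinates_def)
    qed
    ultimately show ?R by (auto simp: boundary_coordinates_def intro!: exI[of _ g])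
  next
    assume ?R
    then obtain g where g: "boundary_coordinates m (top_of_set (cball 0 1)) g"
      "\<And>i x. i \<le> m \<Longrightarrow> x \<in> sphere 0 1 \<Longrightarrow> g i x = \<phi> i x" by blast
    have "continuous_map (top_of_set (cball 0 1)) (top_of_set Y) (\<lambda>x. h (\<Sum>i\<le>m. g i x *\<^sub>R v i))"
      using continuous_map_compose[OF continuous_map_simplex_boundary[OF v g(1)] hc] by (simp add: o_def)
    moreover have "h (\<Sum>i\<le>m. g i x *\<^sub>R v i) = ?f x" if "x \<in> sphere 0 1" for x
      using g(2)[OF _ that] by simp
    ultimately show ?L
      by (intro exI[of _ "\<lambda>x. h (\<Sum>i\<le>m. g i x *\<^sub>R v i)"]) auto
  qed
  finally show ?thesis .
qed

section \<open>Extending covers from the sphere to the ball\<close>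

text \<open>One form for both kinds: an open cover is its own enlargement, a closed one is swollen.
  The inclusion \<open>U i \<subseteq> S i\<close> in the open case records that nothing was added,
  so that \<open>\<phi>\<close> is subordinate to \<open>S\<close> itself.\<close>

lemma open_cover_enlargement:
  assumes X: "normal_space X" and S: "is_cover kind m X S" and S0: "(\<Inter>i\<le>m. S i) = {}"
  obtains U \<phi> where "is_cover Open_Cover m X U" "\<And>i. i \<le> m \<Longrightarrow> S i \<subseteq> U i"
    "\<And>i. kind = Open_Cover \<Longrightarrow> i \<le> m \<Longrightarrow> U i \<subseteq> S i" "(\<Inter>i\<le>m. U i) = {}"
    "subordinate_partition m X U \<phi>"
proof (cases kind)
  case Open_Cover
  with S obtain \<phi> where \<phi>: "subordinate_partition m X S \<phi>"
    using exists_subordinate_partition[OF X] by blast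
  show thesis
    by (rule that[of S \<phi>]) (use Open_Cover S S0 \<phi> in auto)
next
  case Closed_Cover
  with S have C: "is_cover Closed_Cover m X S" by simp
  obtain U where U: "is_cover Open_Cover m X U" "\<And>i. i \<le> m \<Longrightarrow> S i \<subseteq> U i"
    "\<And>J. J \<subseteq> {..m} \<Longrightarrow> (\<Inter>j\<in>J. U j) \<noteq> {} \<longleftrightarrow> (\<Inter>j\<in>J. S j) \<noteq> {}"
    using closed_cover_swelling[OF X C] by blast
  have U0: "(\<Inter>i\<le>m. U i) = {}" using U(3)[OF order_refl] S0 by blast
  obtain \<phi> where \<phi>: "subordinate_partition m X U \<phi>"
    using exists_subordinate_partition[OF X U(1)] by blast
  show thesis
    by (rule that[OF U(1,2) _ U0 \<phi>]) (use Closed_Cover in simp_all)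
qed

text \<open>\<open>U\<close> may be any open enlargement with empty total intersection, whatever its
  other intersections. This freedom matters because an enlargement on the ball restricts to one on
  the sphere whose nerve can be larger than that of \<open>S\<close>.\<close>

lemma cover_class_eq:
  fixes h :: "'c::euclidean_space \<Rightarrow> 'b::euclidean_space"
  assumes X: "normal_space X" and v: "simplex_vertices m v"
    and h: "continuous_map (top_of_set (simplex_boundary m v)) (top_of_set (sphere 0 1)) h"
    and S: "is_cover kind m X S" and S0: "(\<Inter>i\<le>m. S i) = {}"
    and U: "is_cover Open_Cover m X U" and SU: "\<And>i. i \<le> m \<Longrightarrow> S i \<subseteq> U i"
    and US: "\<And>i. kind = Open_Cover \<Longrightarrow> i \<le> m \<Longrightarrow> U i \<subseteq> S i" and U0: "(\<Inter>i\<le>m. U i) = {}"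
    and \<phi>: "subordinate_partition m X U \<phi>"
  shows "cover_class kind m v h X S =
    homotopy_class X (top_of_set (sphere 0 1)) (\<lambda>x. h (\<Sum>i\<le>m. \<phi> i x *\<^sub>R v i))"
proof (cases kind)
  case Open_Cover
  then show ?thesis
    using open_cover_class_eq[OF v h S0 subordinate_partition_mono[OF \<phi> US]] by simp
next
  case Closed_Cover
  then show ?thesis
    using closed_cover_class_eq[OF X v h _ S0 U SU U0 \<phi>] S by simp
qed

text \<open>
  The ball of radius \<open>1/2\<close> carries the given extension, and the collar around it carries the
  radially constant one.
\<close>

lemma boundary_coordinates_collar:
  fixes \<phi> :: "nat \<Rightarrow> 'a::euclidean_space \<Rightarrow> real"
  assumes g: "boundary_coordinates m (top_of_set (cball 0 1)) g"
    and g\<phi>: "\<And>i x. i \<le> m \<Longrightarrow> x \<in> sphere 0 1 \<Longrightarrow> g i x = \<phi> i x"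
  obtains G where "boundary_coordinates m (top_of_set (cball 0 1)) G"
    "\<And>i x. i \<le> m \<Longrightarrow> 1/2 \<le> norm x \<Longrightarrow> G i x = \<phi> i (sgn x)"
proof
  \<comment> \<open>One continuous formula for two regimes: \<open>r\<close> doubles vectors of norm
    at most 1/2 and is the radial projection beyond that radius.\<close>
  define r where "r x = (2 / max 1 (2 * norm x)) *\<^sub>R x" for x :: 'a
  have rcont: "continuous_on A r" for A
    unfolding r_def by (intro continuous_intros) auto
  have rcball: "r x \<in> cball 0 1" for x
    by (auto simp: r_def max_def field_simps)
  show "boundary_coordinates m (top_of_set (cball 0 1)) (\<lambda>i x. g i (r x))"
    unfolding boundary_coordinates_def
  proof (intro conjI allI impI)
    fix i assume "i \<le> m"
    then have "continuous_on (cball 0 1) (g i)" using g by (simp add: boundary_coordinates_def)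
    then show "continuous_map (top_of_set (cball 0 1)) euclideanreal (\<lambda>x. g i (r x))"
      using rcball by (auto intro: continuous_on_compose2 rcont)
  qed (use g rcball in \<open>auto simp: boundary_coordinates_def\<close>)
  fix i and x :: 'a assume i: "i \<le> m" and x: "1/2 \<le> norm x"
  then have "max 1 (2 * norm x) = 2 * norm x" by simp
  then have "r x = sgn x" by (simp only: r_def sgn_div_norm) (simp add: inverse_eq_divide)
  moreover have "sgn x \<in> sphere 0 1" using x by (auto simp: norm_sgn)
  ultimately show "g i (r x) = \<phi> i (sgn x)" using g\<phi> i by simp
qed

text \<open>On the collar \<open>G\<close> is radially constant, and a positive coordinate there
  forces \<open>sgn x\<close> into \<open>S i\<close>. So beyond radius 1/2 the set
  \<open>F i\<close> consists of the points projecting into \<open>S i\<close>, while up to that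
  radius it is the positivity set of \<open>G i\<close>; some coordinate of \<open>G\<close>
  vanishes at every point.\<close>

lemma extend_open_cover_to_ball:
  fixes S :: "nat \<Rightarrow> 'a::euclidean_space set"
  assumes S: "is_cover Open_Cover m (top_of_set (sphere 0 1)) S" and S0: "(\<Inter>i\<le>m. S i) = {}"
    and \<phi>: "subordinate_partition m (top_of_set (sphere 0 1)) S \<phi>"
    and G: "boundary_coordinates m (top_of_set (cball 0 1)) G"
    and G\<phi>: "\<And>i x. i \<le> m \<Longrightarrow> 1/2 \<le> norm x \<Longrightarrow> G i x = \<phi> i (sgn x)"
  shows "\<exists>F. extends_cover Open_Cover m (top_of_set (cball 0 1)) F (sphere 0 1) S \<and>
             (\<Inter>i\<le>m. F i) = {}"
proof -
  let ?B = "cball (0::'a) 1" and ?A = "{x \<in> cball (0::'a) 1. 1/2 < norm x}"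
  define F where "F i = {x \<in> ?B. 0 < G i x} \<union> {x \<in> ?A. sgn x \<in> S i}" for i
  have sgn: "sgn x \<in> sphere 0 1" if "1/2 \<le> norm x" for x :: 'a
    using that by (auto simp: norm_sgn)
  have pos: "sgn x \<in> S i" if "i \<le> m" "1/2 \<le> norm x" "0 < G i x" for i x
    using that G\<phi>[OF that(1,2)] subordinate_partition_zero[OF \<phi>, of "sgn x" i] sgn[OF that(2)]
    by force
  have "openin (top_of_set ?B) (F i)" if i: "i \<le> m" for i
  proof -
    have "openin (top_of_set ?B) {x \<in> topspace (top_of_set ?B). G i x \<in> {0<..}}"
      using G i by (intro openin_continuous_map_preimage[where Y = euclideanreal]) (auto simp: boundary_coordinates_def)
    moreover have "openin (top_of_set ?B) {x \<in> ?A. sgn x \<in> S i}"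
    \<comment> \<open>Radial projection is continuous only away from 0, so openness is proved in the
      open collar and then passed to the ball.\<close>
    proof (rule openin_trans)
      have "continuous_map (top_of_set ?A) (top_of_set (sphere 0 1)) sgn"
        using sgn by (fastforce intro!: continuous_intros)
      then show "openin (top_of_set ?A) {x \<in> ?A. sgn x \<in> S i}"
        using openin_continuous_map_preimage[of "top_of_set ?A" "top_of_set (sphere 0 1)" sgn "S i"] S i
        by (simp add: is_cover_def)
      have "openin (top_of_set ?B) {x \<in> topspace (top_of_set ?B). norm x \<in> {1/2<..}}"
        by (intro openin_continuous_map_preimage[where Y = euclideanreal]) (auto intro: continuous_intros)
      then show "openin (top_of_set ?B) ?A" by simp
    qed
    ultimately show ?thesis unfolding F_def by (intro openin_Un) simp_all
  qed
  moreover have "?B \<subseteq> (\<Union>i\<le>m. F i)"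
  proof
    fix x assume x: "x \<in> ?B"
    then have "(\<Sum>i\<le>m. G i x) = 1" using G by (auto simp: boundary_coordinates_def)
    then have "\<exists>i\<le>m. 0 < G i x"
      by (metis atMost_iff not_le sum_nonpos zero_less_one)
    then show "x \<in> (\<Union>i\<le>m. F i)" using x by (auto simp: F_def)
  qed
  ultimately have "is_cover Open_Cover m (top_of_set ?B) F"
    by (auto simp: is_cover_def F_def)
  moreover have "S i = F i \<inter> sphere 0 1" if i: "i \<le> m" for i
  proof -
    have "S i \<subseteq> sphere 0 1" using S i openin_subset[of "top_of_set (sphere 0 1)" "S i"] by (simp add: is_cover_def)
    \<comment> \<open>On the sphere \<open>sgn x\<close> is \<open>x\<close>, and \<open>pos\<close>
      shows that the positivity part adds nothing beyond \<open>S i\<close>.\<close>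
    moreover have "x \<in> F i \<longleftrightarrow> x \<in> S i" if "x \<in> sphere 0 1" for x
      using that pos[OF i, of x] by (auto simp: F_def sgn_div_norm)
    ultimately show ?thesis by blast
  qed
  moreover have "(\<Inter>i\<le>m. F i) = {}"
  proof (rule ccontr)
    assume "(\<Inter>i\<le>m. F i) \<noteq> {}"
    then obtain x where x: "\<And>i. i \<le> m \<Longrightarrow> x \<in> F i" by auto
    then have xB: "x \<in> ?B" by (auto simp: F_def)
    show False
    proof (cases "1/2 < norm x")
      case True
      then have "sgn x \<in> S i" if "i \<le> m" for i using x[OF that] pos[OF that, of x] by (auto simp: F_def)
      then show False using S0 by blast
    next
      case False
      then have "0 < G i x" if "i \<le> m" for i using x[OF that] by (auto simp: F_def)
      then show False using G xB unfolding boundary_coordinates_def by force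
    qed
  qed
  ultimately show ?thesis
    using S by (intro exI[of _ F]) (auto simp: extends_cover_def inf.absorb2 subtopology_subtopology)
qed

text \<open>\<open>\<phi> i\<close> may be positive outside \<open>S i\<close>, so the inner part is
  confined to radius at most 1/2 and the trace on the sphere stays \<open>S i\<close>. Emptiness of
  the intersection is tested against \<open>U\<close>: a point of \<open>F i\<close> with norm at
  least 1/2 projects into \<open>U i\<close>, whichever part it comes from.\<close>

lemma extend_closed_cover_to_ball:
  fixes S :: "nat \<Rightarrow> 'a::euclidean_space set"
  assumes S: "is_cover Closed_Cover m (top_of_set (sphere 0 1)) S"
    and SU: "\<And>i. i \<le> m \<Longrightarrow> S i \<subseteq> U i" and U0: "(\<Inter>i\<le>m. U i) = {}"
    and \<phi>: "subordinate_partition m (top_of_set (sphere 0 1)) U \<phi>"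
    and G: "boundary_coordinates m (top_of_set (cball 0 1)) G"
    and G\<phi>: "\<And>i x. i \<le> m \<Longrightarrow> 1/2 \<le> norm x \<Longrightarrow> G i x = \<phi> i (sgn x)"
  shows "\<exists>F. extends_cover Closed_Cover m (top_of_set (cball 0 1)) F (sphere 0 1) S \<and>
             (\<Inter>i\<le>m. F i) = {}"
proof -
  let ?B = "cball (0::'a) 1" and ?A = "{x \<in> cball (0::'a) 1. 1/2 \<le> norm x}"
  \<comment> \<open>The threshold is the average of \<open>m + 1\<close> numbers with sum 1: at each
    point some coordinate reaches it, and as it is positive, a vanishing coordinate does
    not.\<close>
  define F where "F i = {x \<in> ?B. norm x \<le> 1/2 \<and> 1 / (real m + 1) \<le> G i x} \<union> {x \<in> ?A. sgn x \<in> S i}" for i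
  have sgn: "sgn x \<in> sphere 0 1" if "1/2 \<le> norm x" for x :: 'a
    using that by (auto simp: norm_sgn)
  have pos: "sgn x \<in> U i" if "i \<le> m" "1/2 \<le> norm x" "0 < G i x" for i x
    using that G\<phi>[OF that(1,2)] subordinate_partition_zero[OF \<phi>, of "sgn x" i] sgn[OF that(2)]
    by force
  have "closedin (top_of_set ?B) (F i)" if i: "i \<le> m" for i
  proof -
    have 1: "closedin (top_of_set ?B) {x \<in> topspace (top_of_set ?B). G i x \<in> {1 / (real m + 1)..}}"
      using G i by (intro closedin_continuous_map_preimage[where Y = euclideanreal]) (auto simp: boundary_coordinates_def)
    have 2: "closedin (top_of_set ?B) {x \<in> topspace (top_of_set ?B). norm x \<in> {..1/2}}"
      by (intro closedin_continuous_map_preimage[where Y = euclideanreal]) (auto intro: continuous_intros)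
    have 3: "closedin (top_of_set ?B) {x \<in> ?A. sgn x \<in> S i}"
    proof (rule closedin_trans)
      have "continuous_map (top_of_set ?A) (top_of_set (sphere 0 1)) sgn"
        using sgn by (fastforce intro!: continuous_intros)
      then show "closedin (top_of_set ?A) {x \<in> ?A. sgn x \<in> S i}"
        using closedin_continuous_map_preimage[of "top_of_set ?A" "top_of_set (sphere 0 1)" sgn "S i"] S i
        by (simp add: is_cover_def)
      have "closedin (top_of_set ?B) {x \<in> topspace (top_of_set ?B). norm x \<in> {1/2..}}"
        by (intro closedin_continuous_map_preimage[where Y = euclideanreal]) (auto intro: continuous_intros)
      then show "closedin (top_of_set ?B) ?A" by simp
    qed
    have "F i = {x \<in> topspace (top_of_set ?B). G i x \<in> {1 / (real m + 1)..}} \<inter>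
        {x \<in> topspace (top_of_set ?B). norm x \<in> {..1/2}} \<union> {x \<in> ?A. sgn x \<in> S i}"
      by (auto simp: F_def)
    then show ?thesis by (simp only:) (intro closedin_Un closedin_Int 1 2 3)
  qed
  moreover have "?B \<subseteq> (\<Union>i\<le>m. F i)"
  proof
    fix x assume x: "x \<in> ?B"
    show "x \<in> (\<Union>i\<le>m. F i)"
    proof (cases "1/2 \<le> norm x")
      case True
      have "sgn x \<in> (\<Union>i\<le>m. S i)" using S sgn[OF True] by (simp add: is_cover_def)
      then obtain i where "i \<le> m" "sgn x \<in> S i" by blast
      then show ?thesis using x True by (auto simp: F_def)
    next
      case False
      have sum: "(\<Sum>i\<le>m. G i x) = 1" using G x by (auto simp: boundary_coordinates_def)
      have "\<exists>i\<le>m. 1 / (real m + 1) \<le> G i x"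
      proof (rule ccontr)
        assume "\<not> ?thesis"
        then have "G i x < 1 / (real m + 1)" if "i \<le> m" for i using that by (meson not_le)
        then have "(\<Sum>i\<le>m. G i x) < (\<Sum>i\<le>m. 1 / (real m + 1))"
          by (intro sum_strict_mono) auto
        then show False using sum by (simp add: field_simps)
      qed
      then show ?thesis using x False by (auto simp: F_def)
    qed
  qed
  ultimately have "is_cover Closed_Cover m (top_of_set ?B) F"
    by (auto simp: is_cover_def F_def)
  moreover have "S i = F i \<inter> sphere 0 1" if i: "i \<le> m" for i
  proof -
    have "S i \<subseteq> sphere 0 1" using S i closedin_subset[of "top_of_set (sphere 0 1)" "S i"] by (simp add: is_cover_def)
    moreover have "x \<in> F i \<longleftrightarrow> x \<in> S i" if "x \<in> sphere 0 1" for x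
      using that by (auto simp: F_def sgn_div_norm)
    ultimately show ?thesis by blast
  qed
  moreover have "(\<Inter>i\<le>m. F i) = {}"
  proof (rule ccontr)
    assume "(\<Inter>i\<le>m. F i) \<noteq> {}"
    then obtain x where x: "\<And>i. i \<le> m \<Longrightarrow> x \<in> F i" by auto
    then have xB: "x \<in> ?B" by (auto simp: F_def)
    have m: "0 < 1 / (real m + 1)" by simp
    show False
    proof (cases "1/2 \<le> norm x")
      case True
      then have "sgn x \<in> U i" if "i \<le> m" for i
        using x[OF that] pos[OF that True] SU[OF that] m
        by (auto simp: F_def dest: less_le_trans[OF m])
      then show False using U0 by blast
    next
      case False
      then have "0 < G i x" if "i \<le> m" for i
        using x[OF that] by (auto simp: F_def dest: less_le_trans[OF m])
      then show False using G xB unfolding boundary_coordinates_def by force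
    qed
  qed
  ultimately show ?thesis
    using S by (intro exI[of _ F]) (auto simp: extends_cover_def inf.absorb2 subtopology_subtopology)
qed

theorem theorem2p1:
  fixes k n :: nat
    and kind :: cover_kind
    and S :: "nat \<Rightarrow> 'a::euclidean_space set"
    and v :: "nat \<Rightarrow> 'c::euclidean_space"
    and h :: "'c \<Rightarrow> 'b::euclidean_space"
  assumes "DIM('a) = k + 1"
    and "DIM('b) = n + 1"
    and "simplex_vertices (n + 1) v"
    and "homeomorphic_map (top_of_set (simplex_boundary (n + 1) v))
           (top_of_set (sphere (0::'b) 1)) h"
    and "is_cover kind (n + 1) (top_of_set (sphere (0::'a) 1)) S"
    and "(\<Inter>i\<le>n + 1. S i) = {}"
  shows "(\<exists>F. extends_cover kind (n + 1) (top_of_set (cball (0::'a) 1)) F (sphere 0 1) S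
            \<and> (\<Inter>i\<le>n + 1. F i) = {})
     \<longleftrightarrow> null_class (top_of_set (sphere (0::'a) 1)) (top_of_set (sphere (0::'b) 1))
           (cover_class kind (n + 1) v h (top_of_set (sphere (0::'a) 1)) S)"
proof -
  let ?m = "n + 1" and ?T = "top_of_set (sphere (0::'a) 1)" and ?B = "top_of_set (cball (0::'a) 1)"
    and ?Y = "top_of_set (sphere (0::'b) 1)"
  note v = assms(3) and h = assms(4) and S = assms(5) and S0 = assms(6)
  have nT: "normal_space ?T" and nB: "normal_space ?B"
    by (simp_all add: metrizable_imp_normal_space metrizable_space_subtopology metrizable_space_euclidean)
  have hc: "continuous_map (top_of_set (simplex_boundary ?m v)) ?Y h"
    using h homeomorphic_imp_continuous_map by blast
  have TB: "subtopology ?B (sphere 0 1) = ?T"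
    by (simp add: subtopology_subtopology inf.absorb2)
  obtain U \<phi> where U: "is_cover Open_Cover ?m ?T U" and SU: "\<And>i. i \<le> ?m \<Longrightarrow> S i \<subseteq> U i"
    and US: "\<And>i. kind = Open_Cover \<Longrightarrow> i \<le> ?m \<Longrightarrow> U i \<subseteq> S i" and U0: "(\<Inter>i\<le>?m. U i) = {}"
    and \<phi>: "subordinate_partition ?m ?T U \<phi>"
    by (rule open_cover_enlargement[OF nT S S0], rule that) blast+
  note cls = cover_class_eq[OF nT v hc S S0 U SU US U0 \<phi>]
  have \<phi>b: "boundary_coordinates ?m ?T \<phi>"
    using subordinate_partition_boundary_coordinates[OF \<phi> U0] .
  show ?thesis
  proof
    assume "\<exists>F. extends_cover kind ?m ?B F (sphere 0 1) S \<and> (\<Inter>i\<le>?m. F i) = {}"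
    then obtain F where "extends_cover kind ?m ?B F (sphere 0 1) S" and F0: "(\<Inter>i\<le>?m. F i) = {}"
      by blast
    then have F: "is_cover kind ?m ?B F" "\<And>i. i \<le> ?m \<Longrightarrow> S i = F i \<inter> sphere 0 1"
      by (simp_all only: extends_cover_def)
    obtain W \<psi> where W: "is_cover Open_Cover ?m ?B W" and FW: "\<And>i. i \<le> ?m \<Longrightarrow> F i \<subseteq> W i"
      and WF: "\<And>i. kind = Open_Cover \<Longrightarrow> i \<le> ?m \<Longrightarrow> W i \<subseteq> F i" and W0: "(\<Inter>i\<le>?m. W i) = {}"
      and \<psi>: "subordinate_partition ?m ?B W \<psi>"
      by (rule open_cover_enlargement[OF nB F(1) F0], rule that) blast+
    \<comment> \<open>An enlargement of \<open>F\<close> on the ball, cut down to the sphere, is an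
      enlargement of \<open>S\<close>; the restriction of \<open>\<psi>\<close> then represents the
      class of \<open>S\<close> and extends to the ball by construction.\<close>
    define W' where "W' = (\<lambda>i. W i \<inter> sphere 0 1)"
    have W'0: "(\<Inter>i\<le>?m. W' i) = {}" using W0 by (auto simp: W'_def)
    have \<psi>': "subordinate_partition ?m ?T W' \<psi>"
      using subordinate_partition_subtopology[OF \<psi>, of "sphere 0 1"] by (simp add: TB W'_def)
    have SW': "S i \<subseteq> W' i" if "i \<le> ?m" for i using F(2)[OF that] FW[OF that] by (auto simp: W'_def)
    have W'S: "W' i \<subseteq> S i" if "kind = Open_Cover" "i \<le> ?m" for i
      using F(2)[OF that(2)] WF[OF that] by (auto simp: W'_def)
    have W': "is_cover Open_Cover ?m ?T W'"
    proof (rule is_cover_open_enlarge[OF S _ SW'])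
      fix i assume i: "i \<le> ?m"
      have "openin (subtopology ?B (sphere 0 1)) (W i \<inter> sphere 0 1)"
        using W i by (intro openin_subtopology_Int) (auto simp: is_cover_def)
      then show "openin ?T (W' i)" by (simp only: TB W'_def)
    qed
    note cover_class_eq[OF nT v hc S S0 W' SW' W'S W'0 \<psi>']
    moreover have "boundary_coordinates ?m ?T \<psi>"
      using subordinate_partition_boundary_coordinates[OF \<psi>' W'0] .
    ultimately show "null_class ?T ?Y (cover_class kind ?m v h ?T S)"
      using null_class_iff_coordinates_extend[OF v h]
        subordinate_partition_boundary_coordinates[OF \<psi> W0] by auto
  next
    assume "null_class ?T ?Y (cover_class kind ?m v h ?T S)"
    then have "\<exists>g. boundary_coordinates ?m ?B g \<and> (\<forall>i\<le>?m. \<forall>x\<in>sphere 0 1. g i x = \<phi> i x)"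
      using null_class_iff_coordinates_extend[OF v h \<phi>b] cls by simp
    then obtain g where g: "boundary_coordinates ?m ?B g"
      "\<And>i x. i \<le> ?m \<Longrightarrow> x \<in> sphere 0 1 \<Longrightarrow> g i x = \<phi> i x"
      by blast
    \<comment> \<open>The reparametrized extension \<open>G\<close> makes the coordinates near the
      sphere depend on the direction alone, as both constructions require.\<close>
    obtain G where G: "boundary_coordinates ?m ?B G"
      "\<And>i x. i \<le> ?m \<Longrightarrow> 1/2 \<le> norm x \<Longrightarrow> G i x = \<phi> i (sgn x)"
      using boundary_coordinates_collar[OF g] by blast
    show "\<exists>F. extends_cover kind ?m ?B F (sphere 0 1) S \<and> (\<Inter>i\<le>?m. F i) = {}"
    proof (cases kind)
      case Open_Cover
      then show ?thesis using extend_open_cover_to_ball[OF _ S0 subordinate_partition_mono[OF \<phi> US] G] S by simp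
    next
      case Closed_Cover
      then show ?thesis using extend_closed_cover_to_ball[OF _ SU U0 \<phi> G] S by simp
    qed
  qed
qed

end
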